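(* Let $f:\mathbb{R}^m\times\mathbb{R}^n\to\mathbb{R}$ be $\ell$-smooth, with $f(\cdot,\mathbf{y})$ $L$-Lipschitz for each $\mathbf{y}\in\mathcal{Y}$ and $f(\mathbf{x},\cdot)$ concave for each $\mathbf{x}\in\mathbb{R}^m$, where $\mathcal{Y}\subset\mathbb{R}^n$ is a convex and bounded set with diameter $D\ge 0$. Put $\Phi(\mathbf{x})=\max_{\mathbf{y}\in\mathcal{Y}}f(\mathbf{x},\mathbf{y})$, $\widehat{\Delta}_\Phi=\Phi_{1/2\ell}(\mathbf{x}_0)-\min_{\mathbf{x}}\Phi_{1/2\ell}(\mathbf{x})$ and $\widehat{\Delta}_0=\Phi(\mathbf{x}_0)-f(\mathbf{x}_0,\mathbf{y}_0)$. Let the step sizes of two-timescale GDA be chosen as $$\eta_{\mathbf{x}}=\Theta\!\left(\frac{\epsilon^4}{\ell^3L^2D^2}\right),\qquad \eta_{\mathbf{y}}=\Theta\!\left(\frac1\ell\right).$$ Then the iteration complexity (also the gradient complexity) of two-timescale GDA to return an $\epsilon$-stationary point of $\Phi$ is bounded by $$O\left(\frac{\ell^3L^2D^2\widehat{\Delta}_\Phi}{\epsilon^6}+\frac{\ell^3D^2\widehat{\Delta}_0}{\epsilon^4}\right).$$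
   Context: A function $g$ is $\ell$-smooth if $\|\nabla g(\mathbf{z})-\nabla g(\mathbf{z}')\|\le\ell\|\mathbf{z}-\mathbf{z}'\|$ for all $\mathbf{z},\mathbf{z}'$ (for $f$: jointly in $(\mathbf{x},\mathbf{y})$), and $L$-Lipschitz if $|g(\mathbf{z})-g(\mathbf{z}')|\le L\|\mathbf{z}-\mathbf{z}'\|$. Norms are Euclidean; $\mathcal{P}_{\mathcal{Y}}$ is Euclidean projection onto $\mathcal{Y}$. The set $\mathcal{Y}$ is understood to be nonempty and closed, so that the maximum and the projection exist, and $\Phi$ is understood to be bounded below. Under these assumptions $\Phi$ is $\ell$-weakly convex, i.e. $\Phi(\cdot)+(\ell/2)\|\cdot\|^2$ is convex. The Moreau envelope $\Phi_{1/2\ell}(\mathbf{x})=\min_{\mathbf{w}}\{\Phi(\mathbf{w})+\ell\|\mathbf{w}-\mathbf{x}\|^2\}$ is differentiable. A point $\mathbf{x}$ is an $\epsilon$-stationary point of $\Phi$ if $\|\nabla\Phi_{1/2\ell}(\mathbf{x})\|\le\epsilon$. Two-timescale GDA: given $(\mathbf{x}_0,\mathbf{y}_0)$ with $\mathbf{y}_0\in\mathcal{Y}$ and stepsizes $(\eta_{\mathbf{x}},\eta_{\mathbf{y}})$, for $t=1,\dots,T$ set $$\mathbf{x}_t=\mathbf{x}_{t-1}-\eta_{\mathbf{x}}\nabla_{\mathbf{x}}f(\mathbf{x}_{t-1},\mathbf{y}_{t-1}),\qquad \mathbf{y}_t=\mathcal{P}_{\mathcal{Y}}\big(\mathbf{y}_{t-1}+\eta_{\mathbf{y}}\nabla_{\mathbf{y}}f(\mathbf{x}_{t-1},\mathbf{y}_{t-1})\big),$$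 and return $\hat{\mathbf{x}}$ drawn uniformly at random from $\{\mathbf{x}_t\}_{t=1}^T$. Returning an $\epsilon$-stationary point is understood for this random output, i.e. $\mathbb{E}\|\nabla\Phi_{1/2\ell}(\hat{\mathbf{x}})\|^2\le\epsilon^2$. The symbols $\Theta(\cdot)$ and $O(\cdot)$ hide absolute constants.
   Formalization: The formal theorem assumes ε ≤ ℓD (hence D > 0). Without this the claim fails: for f = sin x and small D the step η_x can be a multiple of 2π, so no iterate is ever ε-stationary; for D = 0 the step size is undefined. *)

theory Defs
  imports "HOL-Probability.Probability"
begin

definition grad :: "('a::real_inner \<Rightarrow> real) \<Rightarrow> 'a \<Rightarrow> 'a" where
  "grad g z = (THE d. GDERIV g z :> d)"

lemma grad_eqI:
  assumes "GDERIV g z :> d"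
  shows "grad g z = d"
  unfolding grad_def
proof (rule the_equality)
  fix d' assume d': "GDERIV g z :> d'"
  have "(\<lambda>h. inner h d) = (\<lambda>h. inner h d')"
    using assms d' unfolding gderiv_def by (rule has_derivative_unique)
  then have "inner (d' - d) d = inner (d' - d) d'" by (rule fun_cong)
  then have "inner (d' - d) (d' - d) = 0" by (simp only: inner_diff_right)
  then show "d' = d" by simp
qed (rule assms)

definition smooth_fun :: "real \<Rightarrow> ('a::real_inner \<Rightarrow> real) \<Rightarrow> bool" where
  "smooth_fun l g \<longleftrightarrow> (\<forall>z. \<exists>d. GDERIV g z :> d) \<and> l-lipschitz_on UNIV (grad g)"

(* Under the hypotheses of the theorem this supremum is attained. *)
definition primal_fun :: "('a \<times> 'b \<Rightarrow> real) \<Rightarrow> 'b set \<Rightarrow> 'a \<Rightarrow> real" where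
  "primal_fun f Y x = (SUP y\<in>Y. f (x, y))"

(* With r = 1 / (2 * l) the penalty is l * (norm (w - x))^2.  For g continuous and
   bounded below on a Euclidean space and r > 0 the infimum is attained. *)
definition moreau_envelope :: "real \<Rightarrow> ('a::real_normed_vector \<Rightarrow> real) \<Rightarrow> 'a \<Rightarrow> real" where
  "moreau_envelope r g x = (INF w. g w + (norm (w - x))\<^sup>2 / (2 * r))"

(* State after t iterations: the current iterate (x_t, y_t), and the list of the points at
   which the gradient (grad_x f, grad_y f) has been evaluated so far, latest first. *)
primrec gda_run ::
  "('a::euclidean_space \<times> 'b::euclidean_space \<Rightarrow> real) \<Rightarrow> 'b set \<Rightarrow> real \<Rightarrow> real \<Rightarrow> 'a \<times> 'b
    \<Rightarrow> nat \<Rightarrow> ('a \<times> 'b) \<times> ('a \<times> 'b) list" where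
  "gda_run f Y \<eta>x \<eta>y z0 0 = (z0, [])"
| "gda_run f Y \<eta>x \<eta>y z0 (Suc t) =
    (let ((x, y), qs) = gda_run f Y \<eta>x \<eta>y z0 t;
         gx = grad (\<lambda>x'. f (x', y)) x;
         gy = grad (\<lambda>y'. f (x, y')) y
     in ((x - \<eta>x *\<^sub>R gx, closest_point Y (y + \<eta>y *\<^sub>R gy)), (x, y) # qs))"

definition gda_x ::
  "('a::euclidean_space \<times> 'b::euclidean_space \<Rightarrow> real) \<Rightarrow> 'b set \<Rightarrow> real \<Rightarrow> real \<Rightarrow> 'a \<times> 'b
    \<Rightarrow> nat \<Rightarrow> 'a" where
  "gda_x f Y \<eta>x \<eta>y z0 t = fst (fst (gda_run f Y \<eta>x \<eta>y z0 t))"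

definition gda_gradient_evals ::
  "('a::euclidean_space \<times> 'b::euclidean_space \<Rightarrow> real) \<Rightarrow> 'b set \<Rightarrow> real \<Rightarrow> real \<Rightarrow> 'a \<times> 'b
    \<Rightarrow> nat \<Rightarrow> nat" where
  "gda_gradient_evals f Y \<eta>x \<eta>y z0 T = length (snd (gda_run f Y \<eta>x \<eta>y z0 T))"

(* The uniform distribution is over the index t in {1..T}, so points visited repeatedly
   count with multiplicity. *)
definition gda_output ::
  "('a::euclidean_space \<times> 'b::euclidean_space \<Rightarrow> real) \<Rightarrow> 'b set \<Rightarrow> real \<Rightarrow> real \<Rightarrow> 'a \<times> 'b
    \<Rightarrow> nat \<Rightarrow> 'a pmf" where
  "gda_output f Y \<eta>x \<eta>y z0 T = map_pmf (gda_x f Y \<eta>x \<eta>y z0) (pmf_of_set {1..T})"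

(* epsilon-stationarity, with respect to the Moreau envelope of g with parameter
   1 / (2 * l), of a random point with distribution p. *)
definition stationary_in_expectation ::
  "real \<Rightarrow> ('a::euclidean_space \<Rightarrow> real) \<Rightarrow> real \<Rightarrow> 'a pmf \<Rightarrow> bool" where
  "stationary_in_expectation l g \<epsilon> p \<longleftrightarrow>
     measure_pmf.expectation p (\<lambda>x. (norm (grad (moreau_envelope (1 / (2 * l)) g) x))\<^sup>2) \<le> \<epsilon>\<^sup>2"

end

theory Submission
  imports Defs
begin

text \<open>
  The Moreau envelope of \<open>\<Phi>\<close> is a Lyapunov function: comparing at the proximal point of
  \<open>x\<^sub>t\<close>, each descent step lowers it by \<open>\<eta>x / 4\<close> times the squared norm of its gradient, up to
  \<open>2 * l * \<eta>x\<close> times the gap \<open>\<Phi> x\<^sub>t - f (x\<^sub>t, y\<^sub>t)\<close> and a second-order term. Since \<open>\<eta>x\<close> is much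
  smaller than \<open>\<eta>y\<close>, the point \<open>x\<^sub>t\<close> hardly moves during a block of about \<open>(l * D / \<epsilon>)\<^sup>2\<close> steps,
  so within a block the ascent steps act as projected gradient ascent on a fixed concave
  function, and this keeps the average gap of order \<open>\<epsilon>\<^sup>2 / l\<close>.
\<close>

section \<open>Gradients\<close>

lemma smooth_fun_GDERIV:
  assumes "smooth_fun l g"
  shows "GDERIV g z :> grad g z"
  using assms grad_eqI unfolding smooth_fun_def by metis

lemma GDERIV_along_line:
  fixes g :: "'a::real_inner \<Rightarrow> real"
  assumes "GDERIV g (a + s *\<^sub>R v) :> d"
  shows "((\<lambda>s. g (a + s *\<^sub>R v)) has_real_derivative inner v d) (at s)"
proof -
  have "((\<lambda>s. a + s *\<^sub>R v) has_derivative (\<lambda>h. h *\<^sub>R v)) (at s)"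
    by (auto intro!: derivative_eq_intros)
  moreover have "(g has_derivative (\<lambda>h. inner h d)) (at (a + s *\<^sub>R v))"
    using assms by (simp add: gderiv_def)
  ultimately have "(g \<circ> (\<lambda>s. a + s *\<^sub>R v) has_derivative (\<lambda>h. inner h d) \<circ> (\<lambda>h. h *\<^sub>R v)) (at s)"
    by (rule diff_chain_at)
  then have "((\<lambda>s. g (a + s *\<^sub>R v)) has_derivative (\<lambda>h. h * inner v d)) (at s)"
    by (simp add: o_def)
  then show ?thesis
    by (simp add: has_field_derivative_def mult_commute_abs)
qed

text \<open>Along the segment the gradient deviates from \<open>grad g a\<close> by at most
  \<open>l * s * norm v\<close>, so the quadratic correction makes \<open>\<phi>\<close>
  nondecreasing. Freezing \<open>y\<close> will give weak convexity of \<open>\<Phi>\<close>,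
  freezing \<open>x\<close> the progress of an ascent step.\<close>

lemma smooth_fun_quadratic_lower_bound:
  fixes g :: "'a::real_inner \<Rightarrow> real"
  assumes "smooth_fun l g"
  shows "g b \<ge> g a + inner (b - a) (grad g a) - l / 2 * (norm (b - a))\<^sup>2"
proof -
  define v where "v = b - a"
  define \<phi> where "\<phi> s = g (a + s *\<^sub>R v) - s * inner v (grad g a) + l / 2 * s\<^sup>2 * (norm v)\<^sup>2" for s :: real
  have "\<phi> 0 \<le> \<phi> 1"
  proof (rule DERIV_nonneg_imp_nondecreasing[of 0 1 \<phi>])
    fix s :: real
    assume s: "0 \<le> s" "s \<le> 1"
    have d: "(\<phi> has_real_derivative
      inner v (grad g (a + s *\<^sub>R v)) - inner v (grad g a) + l * s * (norm v)\<^sup>2) (at s)"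
      unfolding \<phi>_def
      by (rule derivative_eq_intros GDERIV_along_line[OF smooth_fun_GDERIV[OF assms]] refl)+ simp
    have "l-lipschitz_on UNIV (grad g)"
      using assms by (simp add: smooth_fun_def)
    then have "norm (grad g (a + s *\<^sub>R v) - grad g a) \<le> l * norm (s *\<^sub>R v)"
      using lipschitz_onD[of l UNIV "grad g" "a + s *\<^sub>R v" a] by (simp add: dist_norm)
    then have "norm v * norm (grad g (a + s *\<^sub>R v) - grad g a) \<le> norm v * (l * (s * norm v))"
      using s by (intro mult_left_mono) auto
    moreover have "\<bar>inner v (grad g (a + s *\<^sub>R v) - grad g a)\<bar>
        \<le> norm v * norm (grad g (a + s *\<^sub>R v) - grad g a)"
      by (rule Cauchy_Schwarz_ineq2)
    ultimately have "0 \<le> inner v (grad g (a + s *\<^sub>R v)) - inner v (grad g a) + l * s * (norm v)\<^sup>2"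
      by (simp add: inner_diff_right power2_eq_square algebra_simps)
    with d show "\<exists>y. (\<phi> has_real_derivative y) (at s) \<and> 0 \<le> y"
      by blast
  qed simp
  then show ?thesis
    by (simp add: \<phi>_def v_def)
qed

lemma concave_on_le_tangent:
  fixes g :: "'a::real_inner \<Rightarrow> real"
  assumes "concave_on UNIV g" and "GDERIV g a :> d"
  shows "g b \<le> g a + inner (b - a) d"
proof -
  let ?\<phi> = "\<lambda>s. - g (a + s *\<^sub>R (b - a))"
  have conv: "convex_on UNIV (\<lambda>x. - g x)"
    using assms(1) by (simp add: concave_on_def)
  have "convex_on UNIV ?\<phi>"
  proof (rule convex_onI)
    fix t x y :: real
    assume t: "0 < t" "t < 1"
    have "a + ((1 - t) *\<^sub>R x + t *\<^sub>R y) *\<^sub>R (b - a)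
        = (1 - t) *\<^sub>R (a + x *\<^sub>R (b - a)) + t *\<^sub>R (a + y *\<^sub>R (b - a))"
      by (simp add: algebra_simps)
    then show "?\<phi> ((1 - t) *\<^sub>R x + t *\<^sub>R y) \<le> (1 - t) * ?\<phi> x + t * ?\<phi> y"
      using convex_onD[OF conv, of t "a + x *\<^sub>R (b - a)" "a + y *\<^sub>R (b - a)"] t by simp
  qed simp
  moreover have "(?\<phi> has_real_derivative - inner (b - a) d) (at 0)"
    using GDERIV_along_line[of g a 0 "b - a" d] assms(2) by (auto intro!: derivative_eq_intros)
  ultimately have "?\<phi> 1 - ?\<phi> 0 \<ge> - inner (b - a) d * (1 - 0)"
    by (intro convex_on_imp_above_tangent[of UNIV]) auto
  then show ?thesis
    by simp
qed

text \<open>In the direction \<open>d\<close> itself the slope is the square of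
  \<open>norm d\<close>, while the difference quotients are at most
  \<open>L * norm d\<close>.\<close>

lemma norm_GDERIV_le_lipschitz:
  fixes g :: "'a::real_inner \<Rightarrow> real"
  assumes "L-lipschitz_on UNIV g" and "GDERIV g x :> d"
  shows "norm d \<le> L"
proof -
  have "((\<lambda>s. g (x + s *\<^sub>R d)) has_real_derivative inner d d) (at 0)"
    using GDERIV_along_line[of g x 0 d d] assms(2) by simp
  then have lim: "((\<lambda>s. (g (x + s *\<^sub>R d) - g x) / s) \<longlongrightarrow> inner d d) (at 0)"
    by (simp add: DERIV_def)
  have "(g (x + s *\<^sub>R d) - g x) / s \<le> L * norm d" for s
  proof -
    have "\<bar>g (x + s *\<^sub>R d) - g x\<bar> \<le> L * norm (s *\<^sub>R d)"
      using lipschitz_onD[OF assms(1), of "x + s *\<^sub>R d" x] by (simp add: dist_norm)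
    \<comment> \<open>For \<open>s = 0\<close> the quotient is 0 by convention, and nonnegativity of
      \<open>L\<close> gives the bound.\<close>
    then have "\<bar>(g (x + s *\<^sub>R d) - g x) / s\<bar> \<le> L * norm d"
      using lipschitz_on_nonneg[OF assms(1)]
      by (cases "s = 0") (simp_all add: field_simps)
    then show ?thesis
      by linarith
  qed
  then have "inner d d \<le> L * norm d"
    by (intro tendsto_upperbound[OF lim]) auto
  then have "norm d * norm d \<le> L * norm d"
    by (simp add: norm_eq_sqrt_inner)
  then show ?thesis
    using lipschitz_on_nonneg[OF assms(1)]
    by (cases "norm d = 0") (simp_all add: mult_le_cancel_right)
qed

lemma GDERIV_partial_fst:
  fixes f :: "'a::real_inner \<times> 'b::real_inner \<Rightarrow> real"
  assumes "GDERIV f (x, y) :> d"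
  shows "GDERIV (\<lambda>x'. f (x', y)) x :> fst d"
proof -
  have "((\<lambda>x'. (x', y)) has_derivative (\<lambda>h. (h, 0))) (at x)"
    by (auto intro!: derivative_eq_intros)
  moreover have "(f has_derivative (\<lambda>h. inner h d)) (at (x, y))"
    using assms by (simp add: gderiv_def)
  ultimately have "(f \<circ> (\<lambda>x'. (x', y)) has_derivative (\<lambda>h. inner h d) \<circ> (\<lambda>h. (h, 0))) (at x)"
    by (rule diff_chain_at)
  then show ?thesis
    by (simp add: o_def gderiv_def inner_prod_def)
qed

lemma GDERIV_partial_snd:
  fixes f :: "'a::real_inner \<times> 'b::real_inner \<Rightarrow> real"
  assumes "GDERIV f (x, y) :> d"
  shows "GDERIV (\<lambda>y'. f (x, y')) y :> snd d"
proof -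
  have "((\<lambda>y'. (x, y')) has_derivative (\<lambda>h. (0, h))) (at y)"
    by (auto intro!: derivative_eq_intros)
  moreover have "(f has_derivative (\<lambda>h. inner h d)) (at (x, y))"
    using assms by (simp add: gderiv_def)
  ultimately have "(f \<circ> (\<lambda>y'. (x, y')) has_derivative (\<lambda>h. inner h d) \<circ> (\<lambda>h. (0, h))) (at y)"
    by (rule diff_chain_at)
  then show ?thesis
    by (simp add: o_def gderiv_def inner_prod_def)
qed

section \<open>Moreau envelopes of weakly convex functions\<close>

text \<open>The last assumption is convexity of \<open>g\<close> plus \<open>l / 2\<close> times the
  squared norm, with the convexity defect of the squared norm written out.\<close>

locale weakly_convex =
  fixes l :: real and g :: "'a::euclidean_space \<Rightarrow> real"
  assumes l_pos: "0 < l"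
    and continuous: "continuous_on UNIV g"
    and bounded_below: "bdd_below (range g)"
    and weakly_convex: "\<And>a b \<theta>. 0 \<le> \<theta> \<Longrightarrow> \<theta> \<le> 1 \<Longrightarrow>
      g ((1 - \<theta>) *\<^sub>R a + \<theta> *\<^sub>R b)
        \<le> (1 - \<theta>) * g a + \<theta> * g b + l / 2 * (\<theta> * (1 - \<theta>) * (norm (b - a))\<^sup>2)"
begin

abbreviation env :: "'a \<Rightarrow> real" where
  "env \<equiv> moreau_envelope (1 / (2 * l)) g"

abbreviation pen :: "'a \<Rightarrow> 'a \<Rightarrow> real" where
  "pen x w \<equiv> g w + l * (norm (w - x))\<^sup>2"

lemma env_eq: "env x = (INF w. pen x w)"
  using l_pos by (simp add: moreau_envelope_def mult.commute)

text \<open>Outside the ball of radius \<open>R\<close> the penalty alone is at least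
  \<open>g x - c\<close>, so no point there beats \<open>x\<close>; the ball is compact.\<close>

lemma pen_attains_inf: "\<exists>p. \<forall>w. pen x p \<le> pen x w"
proof -
  obtain c where c: "\<And>w. c \<le> g w"
    using bounded_below unfolding bdd_below_def by (metis rangeI)
  define R where "R = sqrt ((g x - c) / l)"
  have "continuous_on (cball x R) (pen x)"
    by (intro continuous_intros continuous_on_subset[OF continuous]) auto
  moreover have "0 \<le> R"
    using c[of x] l_pos by (simp add: R_def)
  ultimately obtain p where p: "p \<in> cball x R" "\<And>w. w \<in> cball x R \<Longrightarrow> pen x p \<le> pen x w"
    using continuous_attains_inf[of "cball x R" "pen x"] by auto
  have "pen x p \<le> pen x w" for w
  proof (cases "w \<in> cball x R")
    case False
    then have "R\<^sup>2 \<le> (norm (w - x))\<^sup>2"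
      using \<open>0 \<le> R\<close> by (intro power_mono) (auto simp: dist_norm norm_minus_commute)
    then have "(g x - c) / l \<le> (norm (w - x))\<^sup>2"
      using c[of x] l_pos by (simp add: R_def)
    then have "g x - c \<le> l * (norm (w - x))\<^sup>2"
      using l_pos by (simp add: field_simps)
    moreover have "pen x p \<le> pen x x"
      using p(2)[of x] \<open>0 \<le> R\<close> by simp
    ultimately show ?thesis
      using c[of w] by simp
  qed (rule p(2))
  then show ?thesis
    by blast
qed

text \<open>The choice is unambiguous: \<open>pen_quadratic_growth\<close> leaves room for only one
  minimiser.\<close>

definition prox :: "'a \<Rightarrow> 'a" where
  "prox x = (SOME p. \<forall>w. pen x p \<le> pen x w)"

lemma pen_prox_le: "pen x (prox x) \<le> pen x w"
  using someI_ex[OF pen_attains_inf[of x]] by (simp add: prox_def)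

lemma env_eq_prox: "env x = pen x (prox x)"
  unfolding env_eq
  by (rule cInf_eq_minimum) (auto intro: pen_prox_le)

lemma env_le: "env x \<le> pen x w"
  unfolding env_eq_prox by (rule pen_prox_le)

lemma env_bdd_below: "bdd_below (range env)"
proof -
  obtain c where "\<And>w. c \<le> g w"
    using bounded_below unfolding bdd_below_def by (metis rangeI)
  then have "c \<le> env x" for x
    using l_pos by (simp add: env_eq_prox add_increasing2)
  then show ?thesis
    by (auto intro!: bdd_belowI)
qed

text \<open>The penalty has strong convexity modulus \<open>2 * l\<close>, of which weak convexity
  of \<open>g\<close> costs at most \<open>l\<close>. Minimality of \<open>p\<close> is tested on
  the segment towards \<open>w\<close>.\<close>

lemma pen_quadratic_growth: "pen x w \<ge> pen x (prox x) + l / 2 * (norm (w - prox x))\<^sup>2"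
proof -
  define p where "p = prox x"
  have eq: "(norm ((1 - \<theta>) *\<^sub>R p + \<theta> *\<^sub>R w - x))\<^sup>2
      = (1 - \<theta>) * (norm (p - x))\<^sup>2 + \<theta> * (norm (w - x))\<^sup>2 - \<theta> * (1 - \<theta>) * (norm (w - p))\<^sup>2"
    for \<theta> :: real
    unfolding power2_norm_eq_inner
    by (simp add: inner_add_left inner_add_right inner_diff_left inner_diff_right algebra_simps
        inner_commute)
  have ineq: "l / 2 * (1 - \<theta>) * (norm (w - p))\<^sup>2 \<le> pen x w - pen x p" if "0 < \<theta>" "\<theta> < 1" for \<theta>
  proof -
    let ?q = "(1 - \<theta>) *\<^sub>R p + \<theta> *\<^sub>R w"
    have "pen x p \<le> pen x ?q"
      unfolding p_def by (rule pen_prox_le)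
    also have "\<dots> \<le> (1 - \<theta>) * g p + \<theta> * g w + l / 2 * (\<theta> * (1 - \<theta>) * (norm (w - p))\<^sup>2)
        + l * (norm (?q - x))\<^sup>2"
      using weakly_convex[of \<theta> p w] that by simp
    also have "\<dots> = (1 - \<theta>) * pen x p + \<theta> * pen x w - l / 2 * (\<theta> * (1 - \<theta>) * (norm (w - p))\<^sup>2)"
      unfolding eq by (simp add: algebra_simps)
    finally have "\<theta> * (l / 2 * (1 - \<theta>) * (norm (w - p))\<^sup>2) \<le> \<theta> * (pen x w - pen x p)"
      by (simp add: field_simps)
    then show ?thesis
      using that by (simp only: mult_le_cancel_left_pos)
  qed
  \<comment> \<open>Division by \<theta> has left the factor \<open>1 - \<theta>\<close>, which
    disappears as \<theta> tends to 0.\<close>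
  have lim: "((\<lambda>\<theta>. l / 2 * (1 - \<theta>) * (norm (w - p))\<^sup>2) \<longlongrightarrow> l / 2 * (1 - 0) * (norm (w - p))\<^sup>2) (at_right 0)"
    by (intro tendsto_intros)
  have "l / 2 * (1 - 0) * (norm (w - p))\<^sup>2 \<le> pen x w - pen x p"
    by (rule tendsto_upperbound[OF lim]) (use ineq eventually_at_right_less in \<open>auto simp: eventually_at_right_field intro!: exI[of _ 1]\<close>)
  then show ?thesis
    by (simp add: p_def)
qed

text \<open>Adding the growth inequalities at \<open>x\<close> and \<open>z\<close> cancels all
  values of \<open>g\<close>. What remains is \<open>2 * l\<close> times an inner product against
  \<open>l\<close> times a squared norm, hence the factor 2.\<close>

lemma prox_lipschitz: "norm (prox z - prox x) \<le> 2 * norm (z - x)"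
proof -
  define d where "d = prox z - prox x"
  have "pen x (prox z) + pen z (prox x) \<ge> pen x (prox x) + pen z (prox z) + l * (norm d)\<^sup>2"
    using pen_quadratic_growth[of x "prox z"] pen_quadratic_growth[of z "prox x"]
    by (simp add: d_def norm_minus_commute)
  moreover have "pen x (prox z) + pen z (prox x) - pen x (prox x) - pen z (prox z) = l * (2 * inner d (z - x))"
    unfolding power2_norm_eq_inner d_def
    by (simp add: inner_diff_left inner_diff_right algebra_simps inner_commute)
  ultimately have "l * (norm d)\<^sup>2 \<le> l * (2 * inner d (z - x))"
    by linarith
  then have "(norm d)\<^sup>2 \<le> 2 * inner d (z - x)"
    using l_pos by simp
  also have "\<dots> \<le> 2 * (norm d * norm (z - x))"
    using norm_cauchy_schwarz[of d "z - x"] by simp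
  finally have "norm d * norm d \<le> norm d * (2 * norm (z - x))"
    by (simp add: power2_eq_square algebra_simps)
  then show ?thesis
    unfolding d_def[symmetric] by (cases "norm d = 0") (simp_all add: mult_le_cancel_left)
qed

text \<open>The point \<open>prox x\<close> competes at \<open>z\<close>, and \<open>prox z\<close>
  at \<open>x\<close>. Both expansions have the same linear part, with errors quadratic in
  \<open>norm (z - x)\<close>.\<close>

lemma GDERIV_env: "GDERIV env x :> (2 * l) *\<^sub>R (x - prox x)"
proof -
  let ?d = "(2 * l) *\<^sub>R (x - prox x)"
  have upper: "env z - env x - inner (z - x) ?d \<le> l * (norm (z - x))\<^sup>2" for z
  proof -
    have "env z \<le> pen z (prox x)"
      by (rule env_le)
    also have "\<dots> = env x + inner (z - x) ?d + l * (norm (z - x))\<^sup>2"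
      unfolding env_eq_prox power2_norm_eq_inner
      by (simp add: inner_diff_left inner_diff_right algebra_simps inner_commute)
    finally show ?thesis
      by simp
  qed
  \<comment> \<open>The estimates even give the constant 3; 5 leaves slack.\<close>
  have lower: "env z - env x - inner (z - x) ?d \<ge> - (5 * l * (norm (z - x))\<^sup>2)" for z
  proof -
    have "env x \<le> pen x (prox z)"
      by (rule env_le)
    also have "\<dots> = env z - inner (z - x) ?d - l * (norm (z - x))\<^sup>2 + 2 * l * inner (prox z - prox x) (z - x)"
      unfolding env_eq_prox power2_norm_eq_inner
      by (simp add: inner_diff_left inner_diff_right algebra_simps inner_commute)
    finally have "env z - env x - inner (z - x) ?d
        \<ge> l * (norm (z - x))\<^sup>2 - 2 * l * inner (prox z - prox x) (z - x)"
      by simp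
    moreover have "inner (prox z - prox x) (z - x) \<le> 2 * (norm (z - x))\<^sup>2"
    proof -
      have "inner (prox z - prox x) (z - x) \<le> norm (prox z - prox x) * norm (z - x)"
        by (rule norm_cauchy_schwarz)
      also have "\<dots> \<le> 2 * norm (z - x) * norm (z - x)"
        by (intro mult_right_mono prox_lipschitz) simp
      finally show ?thesis
        by (simp add: power2_eq_square)
    qed
    then have "2 * l * inner (prox z - prox x) (z - x) \<le> 2 * l * (2 * (norm (z - x))\<^sup>2)"
      using l_pos by (intro mult_left_mono) auto
    moreover have "0 \<le> l * (norm (z - x))\<^sup>2"
      using l_pos by simp
    ultimately show ?thesis
      by linarith
  qed
  have bound: "norm (env z - env x - inner (z - x) ?d) \<le> (5 * l * norm (z - x)) * norm (z - x)" for z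
  proof -
    have "0 \<le> l * (norm (z - x))\<^sup>2"
      using l_pos by simp
    with upper[of z] lower[of z] show ?thesis
      by (simp add: power2_eq_square abs_le_iff algebra_simps)
  qed
  have "(env has_derivative (\<lambda>h. inner h ?d)) (at x)"
    unfolding has_derivative_at_alt
  proof (intro conjI allI impI)
    show "bounded_linear (\<lambda>h. inner h ?d)"
      by (rule bounded_linear_inner_left)
    fix e :: real
    assume e: "0 < e"
    show "\<exists>d>0. \<forall>y. norm (y - x) < d \<longrightarrow> norm (env y - env x - inner (y - x) ?d) \<le> e * norm (y - x)"
    proof (intro exI[of _ "e / (5 * l)"] conjI allI impI)
      show "0 < e / (5 * l)"
        using e l_pos by simp
      fix y
      assume "norm (y - x) < e / (5 * l)"
      then have "5 * l * norm (y - x) \<le> e"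
        using l_pos by (simp add: field_simps)
      then have "(5 * l * norm (y - x)) * norm (y - x) \<le> e * norm (y - x)"
        by (intro mult_right_mono) auto
      with bound[of y] show "norm (env y - env x - inner (y - x) ?d) \<le> e * norm (y - x)"
        by linarith
    qed
  qed
  then show ?thesis
    by (simp add: gderiv_def)
qed

lemma norm_grad_env: "norm (grad env x) = 2 * l * norm (prox x - x)"
  using l_pos by (simp add: grad_eqI[OF GDERIV_env] norm_minus_commute)

text \<open>Comparison with \<open>w = x\<close> bounds the displacement of \<open>prox x\<close>.
  This settles the case \<open>L = 0\<close> of the final estimate.\<close>

lemma norm_grad_env_le:
  assumes "L-lipschitz_on UNIV g"
  shows "norm (grad env x) \<le> 2 * L"
proof -
  have "l * (norm (prox x - x))\<^sup>2 \<le> g x - g (prox x)"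
    using pen_prox_le[of x x] by simp
  also have "\<dots> \<le> L * norm (prox x - x)"
    using lipschitz_onD[OF assms, of x "prox x"] by (simp add: dist_norm norm_minus_commute)
  finally have "l * norm (prox x - x) * norm (prox x - x) \<le> L * norm (prox x - x)"
    by (simp add: power2_eq_square mult.assoc)
  then have "l * norm (prox x - x) \<le> L"
    using lipschitz_on_nonneg[OF assms] by (cases "norm (prox x - x) = 0") (simp_all add: mult_le_cancel_right)
  then show ?thesis
    by (simp add: norm_grad_env)
qed

end

section \<open>The primal function\<close>

locale nonconvex_concave =
  fixes f :: "'a::euclidean_space \<times> 'b::euclidean_space \<Rightarrow> real"
    and Y :: "'b set" and l L :: real
  assumes l_pos: "0 < l"
    and smooth: "smooth_fun l f"
    and lipschitz: "\<And>y. y \<in> Y \<Longrightarrow> L-lipschitz_on UNIV (\<lambda>x. f (x, y))"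
    and concave: "\<And>x. concave_on UNIV (\<lambda>y. f (x, y))"
    and convex_Y: "convex Y" and bounded_Y: "bounded Y" and closed_Y: "closed Y"
    and nonempty_Y: "Y \<noteq> {}"
    and primal_bdd_below: "bdd_below (range (primal_fun f Y))"
begin

abbreviation \<Phi> :: "'a \<Rightarrow> real" where
  "\<Phi> \<equiv> primal_fun f Y"

abbreviation grad_x :: "'a \<Rightarrow> 'b \<Rightarrow> 'a" where
  "grad_x x y \<equiv> fst (grad f (x, y))"

abbreviation grad_y :: "'a \<Rightarrow> 'b \<Rightarrow> 'b" where
  "grad_y x y \<equiv> snd (grad f (x, y))"

lemma GDERIV_x: "GDERIV (\<lambda>x'. f (x', y)) x :> grad_x x y"
  by (intro GDERIV_partial_fst smooth_fun_GDERIV[OF smooth])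

lemma GDERIV_y: "GDERIV (\<lambda>y'. f (x, y')) y :> grad_y x y"
  by (intro GDERIV_partial_snd smooth_fun_GDERIV[OF smooth])

lemma L_nonneg: "0 \<le> L"
  using lipschitz nonempty_Y lipschitz_on_nonneg by blast

lemma norm_grad_x_le: "y \<in> Y \<Longrightarrow> norm (grad_x x y) \<le> L"
  using norm_GDERIV_le_lipschitz[OF lipschitz GDERIV_x] .

lemma lower_bound_x: "f (x', y) \<ge> f (x, y) + inner (x' - x) (grad_x x y) - l / 2 * (norm (x' - x))\<^sup>2"
  using smooth_fun_quadratic_lower_bound[OF smooth, of "(x, y)" "(x', y)"]
  by (simp add: inner_prod_def norm_Pair)

lemma lower_bound_y: "f (x, y') \<ge> f (x, y) + inner (y' - y) (grad_y x y) - l / 2 * (norm (y' - y))\<^sup>2"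
  using smooth_fun_quadratic_lower_bound[OF smooth, of "(x, y)" "(x, y')"]
  by (simp add: inner_prod_def norm_Pair)

lemma lipschitz_le: "y \<in> Y \<Longrightarrow> f (x', y) \<le> f (x, y) + L * norm (x' - x)"
  using lipschitz_onD[OF lipschitz, of y x' x] by (simp add: dist_norm)

lemma primal_attained: "\<exists>y\<in>Y. \<forall>y'\<in>Y. f (x, y') \<le> f (x, y)"
proof -
  have "isCont (\<lambda>y. f (x, y)) y" for y
    using GDERIV_y[of x y] by (auto simp: gderiv_def intro: has_derivative_continuous)
  then have "continuous_on Y (\<lambda>y. f (x, y))"
    by (simp add: continuous_at_imp_continuous_on)
  moreover have "compact Y"
    using bounded_Y closed_Y by (simp add: compact_eq_bounded_closed)
  ultimately show ?thesis
    using continuous_attains_sup[of Y "\<lambda>y. f (x, y)"] nonempty_Y by auto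
qed

text \<open>Under mere concavity maximisers can be non-unique, and \<open>best x\<close> may jump as
  \<open>x\<close> varies; later estimates therefore freeze it at the start of a block.\<close>

definition best :: "'a \<Rightarrow> 'b" where
  "best x = (SOME y. y \<in> Y \<and> (\<forall>y'\<in>Y. f (x, y') \<le> f (x, y)))"

lemma best: "best x \<in> Y" "y \<in> Y \<Longrightarrow> f (x, y) \<le> f (x, best x)"
proof -
  have "\<exists>y. y \<in> Y \<and> (\<forall>y'\<in>Y. f (x, y') \<le> f (x, y))"
    using primal_attained by blast
  from someI_ex[OF this] show "best x \<in> Y" "y \<in> Y \<Longrightarrow> f (x, y) \<le> f (x, best x)"
    by (simp_all add: best_def)
qed

lemma primal_eq: "\<Phi> x = f (x, best x)"
  unfolding primal_fun_def by (rule cSup_eq_maximum) (auto intro: best)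

lemma le_primal: "y \<in> Y \<Longrightarrow> f (x, y) \<le> \<Phi> x"
  unfolding primal_eq by (rule best)

lemma primal_le: "\<Phi> x' \<le> \<Phi> x + L * norm (x' - x)"
  using lipschitz_le[OF best(1), of x' x' x] le_primal[OF best(1), of x x'] by (simp add: primal_eq)

lemma primal_lipschitz: "L-lipschitz_on UNIV \<Phi>"
proof (rule lipschitz_onI)
  fix x x'
  show "dist (\<Phi> x) (\<Phi> x') \<le> L * dist x x'"
    using primal_le[of x x'] primal_le[of x' x]
    by (simp add: dist_norm norm_minus_commute abs_le_iff)
qed (rule L_nonneg)

text \<open>For \<open>y\<close> a maximiser at the intermediate point, \<open>f (_, y)\<close> lies
  below \<Phi> and touches it there. Averaging its quadratic lower bounds at \<open>a\<close> and
  \<open>b\<close> cancels the linear terms.\<close>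

lemma primal_weakly_convex:
  assumes "0 \<le> \<theta>" "\<theta> \<le> 1"
  shows "\<Phi> ((1 - \<theta>) *\<^sub>R a + \<theta> *\<^sub>R b)
    \<le> (1 - \<theta>) * \<Phi> a + \<theta> * \<Phi> b + l / 2 * (\<theta> * (1 - \<theta>) * (norm (b - a))\<^sup>2)"
proof -
  define p where "p = (1 - \<theta>) *\<^sub>R a + \<theta> *\<^sub>R b"
  define y where "y = best p"
  define v where "v = inner (b - a) (grad_x p y)"
  define N where "N = l / 2 * (norm (b - a))\<^sup>2"
  have y: "y \<in> Y"
    by (simp add: y_def best)
  have ap: "a - p = (- \<theta>) *\<^sub>R (b - a)" and bp: "b - p = (1 - \<theta>) *\<^sub>R (b - a)"
    by (simp_all add: p_def algebra_simps)
  have "\<Phi> a \<ge> \<Phi> p - \<theta> * v - \<theta>\<^sup>2 * N"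
    using le_primal[OF y, of a] lower_bound_x[of p y a]
    by (simp add: ap primal_eq[of p] y_def[symmetric] v_def N_def power_mult_distrib mult.commute mult.left_commute)
  then have "(1 - \<theta>) * \<Phi> a \<ge> (1 - \<theta>) * (\<Phi> p - \<theta> * v - \<theta>\<^sup>2 * N)"
    using assms by (intro mult_left_mono) auto
  moreover have "\<Phi> b \<ge> \<Phi> p + (1 - \<theta>) * v - (1 - \<theta>)\<^sup>2 * N"
    using le_primal[OF y, of b] lower_bound_x[of p y b]
    by (simp add: bp primal_eq[of p] y_def[symmetric] v_def N_def power_mult_distrib mult.commute mult.left_commute)
  then have "\<theta> * \<Phi> b \<ge> \<theta> * (\<Phi> p + (1 - \<theta>) * v - (1 - \<theta>)\<^sup>2 * N)"
    using assms by (intro mult_left_mono) auto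
  moreover have "(1 - \<theta>) * (\<Phi> p - \<theta> * v - \<theta>\<^sup>2 * N) + \<theta> * (\<Phi> p + (1 - \<theta>) * v - (1 - \<theta>)\<^sup>2 * N)
      = \<Phi> p - \<theta> * (1 - \<theta>) * N"
    by (simp add: algebra_simps power2_eq_square)
  ultimately have "\<Phi> p \<le> (1 - \<theta>) * \<Phi> a + \<theta> * \<Phi> b + \<theta> * (1 - \<theta>) * N"
    by linarith
  then show ?thesis
    by (simp add: p_def N_def mult.commute mult.left_commute)
qed

sublocale weakly_convex l \<Phi>
  by unfold_locales
    (use l_pos primal_bdd_below lipschitz_on_continuous_on[OF primal_lipschitz] primal_weakly_convex in simp_all)

text \<open>The old proximal point \<open>p\<close> competes in the envelope at the new point. The
  resulting \<open>inner (p - x) g\<close> is negative up to the gap, since \<open>f (p, y)\<close>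
  is at most \<open>\<Phi> p\<close>, which lies below \<open>\<Phi> x\<close> by at least
  \<open>l * (norm (p - x))\<^sup>2\<close>.\<close>

lemma env_gradient_step_le:
  assumes "y \<in> Y" "0 \<le> \<eta>"
  shows "env (x - \<eta> *\<^sub>R grad_x x y)
    \<le> env x + 2 * l * \<eta> * (\<Phi> x - f (x, y)) - \<eta> / 4 * (norm (grad env x))\<^sup>2 + l * \<eta>\<^sup>2 * L\<^sup>2"
proof -
  define p where "p = prox x"
  define g where "g = grad_x x y"
  have "f (p, y) \<le> \<Phi> p"
    using assms by (intro le_primal)
  moreover have "\<Phi> p + l * (norm (p - x))\<^sup>2 \<le> \<Phi> x"
    using pen_prox_le[of x x] by (simp add: p_def)
  ultimately have "inner (p - x) g \<le> (\<Phi> x - f (x, y)) - l / 2 * (norm (p - x))\<^sup>2"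
    using lower_bound_x[of x y p] by (simp add: g_def)
  then have inner: "2 * l * \<eta> * inner (p - x) g
      \<le> 2 * l * \<eta> * ((\<Phi> x - f (x, y)) - l / 2 * (norm (p - x))\<^sup>2)"
    using assms l_pos by (intro mult_left_mono) auto
  have "env (x - \<eta> *\<^sub>R g) \<le> pen (x - \<eta> *\<^sub>R g) p"
    by (rule env_le)
  also have "\<dots> = env x + 2 * l * \<eta> * inner (p - x) g + l * \<eta>\<^sup>2 * (norm g)\<^sup>2"
    unfolding env_eq_prox p_def[symmetric] power2_norm_eq_inner
    by (simp add: inner_diff_left inner_diff_right algebra_simps inner_commute power2_eq_square)
  also have "\<dots> \<le> env x + 2 * l * \<eta> * ((\<Phi> x - f (x, y)) - l / 2 * (norm (p - x))\<^sup>2) + l * \<eta>\<^sup>2 * L\<^sup>2"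
  proof -
    have "l * \<eta>\<^sup>2 * (norm g)\<^sup>2 \<le> l * \<eta>\<^sup>2 * L\<^sup>2"
      using l_pos norm_grad_x_le[OF assms(1), of x] by (intro mult_left_mono power_mono) (auto simp: g_def)
    with inner show ?thesis
      by linarith
  qed
  \<comment> \<open>By \<open>norm_grad_env\<close> the gradient has norm
    \<open>2 * l * norm (p - x)\<close>, whence the factor \<open>\<eta> / 4\<close>.\<close>
  also have "2 * l * \<eta> * ((\<Phi> x - f (x, y)) - l / 2 * (norm (p - x))\<^sup>2)
      = 2 * l * \<eta> * (\<Phi> x - f (x, y)) - \<eta> / 4 * (norm (grad env x))\<^sup>2"
    unfolding norm_grad_env p_def by (simp add: algebra_simps power2_eq_square)
  finally show ?thesis
    by (simp add: g_def)
qed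

text \<open>The obtuse angle at the projection gives a three-point inequality, concavity brings in
  \<open>z\<close>, and for \<open>\<eta> \<le> 1 / l\<close> the term in
  \<open>norm (y' - y)\<close> absorbs the smoothness error. The right side telescopes as long as
  \<open>z\<close> is kept.\<close>

lemma ascent_step:
  fixes x :: 'a and y :: 'b
  assumes "z \<in> Y" "0 < \<eta>" "\<eta> \<le> 1 / l"
  defines "y' \<equiv> closest_point Y (y + \<eta> *\<^sub>R grad_y x y)"
  shows "f (x, z) - f (x, y') \<le> 1 / (2 * \<eta>) * ((norm (z - y))\<^sup>2 - (norm (z - y'))\<^sup>2)"
proof -
  define g where "g = grad_y x y"
  have "inner (y + \<eta> *\<^sub>R g - y') (z - y') \<le> 0"
    unfolding y'_def g_def using convex_Y closed_Y assms(1) by (rule closest_point_dot)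
  then have "2 * \<eta> * inner (z - y') g \<le> (norm (z - y))\<^sup>2 - (norm (z - y'))\<^sup>2 - (norm (y' - y))\<^sup>2"
    unfolding power2_norm_eq_inner
    by (simp add: inner_diff_left inner_diff_right inner_add_left algebra_simps inner_commute)
  then have "inner (z - y') g
      \<le> ((norm (z - y))\<^sup>2 - (norm (z - y'))\<^sup>2 - (norm (y' - y))\<^sup>2) / (2 * \<eta>)"
    using assms(2) by (simp add: pos_le_divide_eq mult.commute)
  then have "inner (z - y') g
      \<le> 1 / (2 * \<eta>) * ((norm (z - y))\<^sup>2 - (norm (z - y'))\<^sup>2) - 1 / (2 * \<eta>) * (norm (y' - y))\<^sup>2"
    by (simp add: diff_divide_distrib right_diff_distrib)
  moreover have "f (x, z) \<le> f (x, y) + inner (z - y) g"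
    unfolding g_def by (rule concave_on_le_tangent[OF concave GDERIV_y])
  moreover have "f (x, y') \<ge> f (x, y) + inner (y' - y) g - l / 2 * (norm (y' - y))\<^sup>2"
    unfolding g_def by (rule lower_bound_y)
  moreover have "l / 2 * (norm (y' - y))\<^sup>2 \<le> 1 / (2 * \<eta>) * (norm (y' - y))\<^sup>2"
    using assms(2,3) l_pos by (intro mult_right_mono) (simp_all add: field_simps)
  ultimately show ?thesis
    by (simp add: inner_diff_left)
qed

end

section \<open>Two-timescale gradient descent ascent\<close>

locale gda = nonconvex_concave f Y l L
  for f :: "'a::euclidean_space \<times> 'b::euclidean_space \<Rightarrow> real" and Y l L +
  fixes \<eta>x \<eta>y :: real and x0 :: 'a and y0 :: 'b
  assumes y0_in: "y0 \<in> Y"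
    and \<eta>x_nonneg: "0 \<le> \<eta>x"
    and \<eta>y_ge: "1 / 2 * (1 / l) \<le> \<eta>y" and \<eta>y_le: "\<eta>y \<le> 1 / l"
begin

abbreviation xs :: "nat \<Rightarrow> 'a" where
  "xs \<equiv> gda_x f Y \<eta>x \<eta>y (x0, y0)"

definition ys :: "nat \<Rightarrow> 'b" where
  "ys t = snd (fst (gda_run f Y \<eta>x \<eta>y (x0, y0) t))"

text \<open>The value \<open>gap 0\<close> is \<open>\<Delta>0\<close> in the theorem.\<close>

definition gap :: "nat \<Rightarrow> real" where
  "gap t = \<Phi> (xs t) - f (xs t, ys t)"

lemma xs_0 [simp]: "xs 0 = x0" and ys_0 [simp]: "ys 0 = y0"
  by (simp_all add: gda_x_def ys_def)

lemma xs_Suc: "xs (Suc t) = xs t - \<eta>x *\<^sub>R grad_x (xs t) (ys t)"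
  using grad_eqI[OF GDERIV_x] by (simp add: gda_x_def ys_def split_beta Let_def)

lemma ys_Suc: "ys (Suc t) = closest_point Y (ys t + \<eta>y *\<^sub>R grad_y (xs t) (ys t))"
  using grad_eqI[OF GDERIV_y] by (simp add: gda_x_def ys_def split_beta Let_def)

lemma ys_in: "ys t \<in> Y"
  by (cases t) (simp_all add: y0_in ys_Suc closest_point_in_set closed_Y nonempty_Y)

lemma \<eta>y_pos: "0 < \<eta>y"
  using \<eta>y_ge l_pos by (smt (verit) divide_pos_pos zero_less_mult_iff)

lemma gap_nonneg: "0 \<le> gap t"
  by (simp add: gap_def le_primal ys_in)

section \<open>Drift of the iterates and of the gap\<close>

lemma norm_xs_Suc_diff: "norm (xs (Suc t) - xs t) \<le> \<eta>x * L"
  using norm_grad_x_le[OF ys_in, of "xs t" t] \<eta>x_nonneg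
  by (simp add: xs_Suc mult_left_mono)

lemma norm_xs_diff: "norm (xs (s + k) - xs s) \<le> real k * (\<eta>x * L)"
proof (induction k)
  case (Suc k)
  have "norm (xs (s + Suc k) - xs s) \<le> norm (xs (s + Suc k) - xs (s + k)) + norm (xs (s + k) - xs s)"
    using norm_triangle_ineq[of "xs (s + Suc k) - xs (s + k)" "xs (s + k) - xs s"] by simp
  with Suc norm_xs_Suc_diff[of "s + k"] show ?case
    by (simp add: algebra_simps)
qed simp

text \<open>Passing from \<open>xs t\<close> to \<open>xs (Suc t)\<close> costs
  \<open>\<eta>x * L\<^sup>2\<close> in \<open>f\<close> and again in \<open>\<Phi>\<close>; the
  rest is a telescoping difference of gaps.\<close>

lemma ascent_gap_le: "f (xs t, ys (Suc t)) - f (xs t, ys t) \<le> 2 * (\<eta>x * L\<^sup>2) + gap t - gap (Suc t)"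
proof -
  have "L * norm (xs (Suc t) - xs t) \<le> \<eta>x * L\<^sup>2"
    using mult_left_mono[OF norm_xs_Suc_diff L_nonneg, of t] by (simp add: power2_eq_square algebra_simps)
  then show ?thesis
    using lipschitz_le[OF ys_in[of "Suc t"], of "xs t" "xs (Suc t)"] primal_le[of "xs (Suc t)" "xs t"]
    by (simp add: gap_def norm_minus_commute)
qed

lemma gap_Suc_le: "gap (Suc t) \<le> gap t + 2 * (\<eta>x * L\<^sup>2)"
proof -
  \<comment> \<open>With \<open>ys t\<close> itself as comparison point, the ascent step is seen not
    to decrease \<open>f\<close> at fixed \<open>x\<close>.\<close>
  have "f (xs t, ys t) - f (xs t, ys (Suc t)) \<le> 1 / (2 * \<eta>y) * (0 - (norm (ys t - ys (Suc t)))\<^sup>2)"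
    using ascent_step[OF ys_in[of t] \<eta>y_pos \<eta>y_le, of "xs t" "ys t"] by (simp add: ys_Suc)
  also have "\<dots> \<le> 0"
    using \<eta>y_pos by simp
  finally show ?thesis
    using ascent_gap_le[of t] by simp
qed

text \<open>Serves runs shorter than one block: the gap grows at most linearly, and no cost in the
  diameter arises.\<close>

lemma sum_gap_le: "(\<Sum>t<N. gap t) \<le> real N * gap 0 + \<eta>x * L\<^sup>2 * (real N)\<^sup>2"
proof (induction N)
  case (Suc N)
  have "gap N \<le> gap 0 + 2 * (\<eta>x * L\<^sup>2) * real N"
  proof (induction N)
    case (Suc N)
    then show ?case
      using gap_Suc_le[of N] by (simp add: algebra_simps)
  qed simp
  moreover have "0 \<le> \<eta>x * L\<^sup>2"
    using \<eta>x_nonneg by simp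
  ultimately show ?case
    using Suc by (simp add: algebra_simps power2_eq_square)
qed simp

text \<open>The ascent steps of a block are compared with the fixed point \<^term>\<open>best (xs s)\<close>, so that
  the distances to it telescope; its suboptimality at later iterates costs the terms in
  \<^term>\<open>\<eta>x * L\<^sup>2\<close>.\<close>

lemma sum_gap_block_le:
  "(\<Sum>j<k. gap (s + j)) \<le> \<eta>x * L\<^sup>2 * (real k * (real k + 1))
    + 1 / (2 * \<eta>y) * ((norm (best (xs s) - ys s))\<^sup>2 - (norm (best (xs s) - ys (s + k)))\<^sup>2)
    + gap s - gap (s + k)"
proof (induction k)
  case (Suc k)
  define z where "z = best (xs s)"
  have z: "z \<in> Y"
    by (simp add: z_def best)
  let ?t = "s + k"
  have "L * norm (xs ?t - xs s) \<le> \<eta>x * L\<^sup>2 * real k"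
    using mult_left_mono[OF norm_xs_diff L_nonneg, of s k] by (simp add: power2_eq_square algebra_simps)
  \<comment> \<open>Going back to \<open>xs s\<close>, where \<open>z\<close> is optimal, and forth
    again uses the drift twice.\<close>
  then have "\<Phi> (xs ?t) \<le> f (xs ?t, z) + 2 * (\<eta>x * L\<^sup>2 * real k)"
    using primal_le[of "xs ?t" "xs s"] lipschitz_le[OF z, of "xs s" "xs ?t"]
    by (simp add: primal_eq[of "xs s"] z_def norm_minus_commute)
  moreover have "f (xs ?t, z) - f (xs ?t, ys (Suc ?t))
      \<le> 1 / (2 * \<eta>y) * ((norm (z - ys ?t))\<^sup>2 - (norm (z - ys (Suc ?t)))\<^sup>2)"
    using ascent_step[OF z \<eta>y_pos \<eta>y_le] by (simp add: ys_Suc)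
  ultimately have "gap ?t \<le> 2 * (\<eta>x * L\<^sup>2 * real k)
      + 1 / (2 * \<eta>y) * ((norm (z - ys ?t))\<^sup>2 - (norm (z - ys (Suc ?t)))\<^sup>2)
      + 2 * (\<eta>x * L\<^sup>2) + gap ?t - gap (Suc ?t)"
    using ascent_gap_le[of ?t] unfolding gap_def[of ?t] by linarith
  \<comment> \<open>The drift coefficients \<open>2 * (j + 1)\<close> for \<open>j \<le> k\<close>
    add up to \<open>(k + 1) * (k + 2)\<close>.\<close>
  with Suc show ?case
    unfolding z_def[symmetric] by (simp add: algebra_simps)
qed simp

section \<open>Sums over blocks and over the whole run\<close>

lemma sum_gap_add: "(\<Sum>t<n + k. gap t) = (\<Sum>t<n. gap t) + (\<Sum>j<k. gap (n + j))"
  by (induction k) simp_all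

text \<open>Each block restarts with a new comparison point at a cost of at most
  \<open>l * (diameter Y)\<^sup>2\<close>; the gaps at the block ends telescope.\<close>

lemma sum_gap_blocks_le:
  "(\<Sum>t<m * b. gap t)
    \<le> real m * (\<eta>x * L\<^sup>2 * (real b * (real b + 1)) + l * (diameter Y)\<^sup>2) + gap 0 - gap (m * b)"
proof (induction m)
  case (Suc m)
  let ?z = "best (xs (m * b))"
  have "norm (?z - ys (m * b)) \<le> diameter Y"
    using diameter_bounded_bound[OF bounded_Y best(1) ys_in] by (simp add: dist_norm)
  then have "(norm (?z - ys (m * b)))\<^sup>2 \<le> (diameter Y)\<^sup>2"
    by (intro power_mono) auto
  then have "(norm (?z - ys (m * b)))\<^sup>2 - (norm (?z - ys (m * b + b)))\<^sup>2 \<le> (diameter Y)\<^sup>2"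
    by (smt (verit) zero_le_power2)
  then have "1 / (2 * \<eta>y) * ((norm (?z - ys (m * b)))\<^sup>2 - (norm (?z - ys (m * b + b)))\<^sup>2)
      \<le> 1 / (2 * \<eta>y) * (diameter Y)\<^sup>2"
    using \<eta>y_pos by (intro mult_left_mono) auto
  \<comment> \<open>Here the lower bound on \<open>\<eta>y\<close> enters.\<close>
  also have "\<dots> \<le> l * (diameter Y)\<^sup>2"
    using \<eta>y_ge \<eta>y_pos l_pos by (intro mult_right_mono) (auto simp: field_simps)
  finally have "(\<Sum>j<b. gap (m * b + j))
      \<le> \<eta>x * L\<^sup>2 * (real b * (real b + 1)) + l * (diameter Y)\<^sup>2 + gap (m * b) - gap (m * b + b)"
    using sum_gap_block_le[of "m * b" b] by linarith
  moreover have "(\<Sum>t<Suc m * b. gap t) = (\<Sum>t<m * b. gap t) + (\<Sum>j<b. gap (m * b + j))"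
    using sum_gap_add[of "m * b" b] by (simp add: add.commute)
  ultimately show ?case
    using Suc by (simp add: algebra_simps)
qed simp

lemma sum_grad_env_le:
  "\<eta>x / 4 * (\<Sum>t<N. (norm (grad env (xs t)))\<^sup>2)
    \<le> env x0 - (INF x. env x) + 2 * l * \<eta>x * (\<Sum>t<N. gap t) + real N * (l * \<eta>x\<^sup>2 * L\<^sup>2)"
proof -
  have "\<eta>x / 4 * (\<Sum>t<N. (norm (grad env (xs t)))\<^sup>2)
      \<le> env x0 - env (xs N) + 2 * l * \<eta>x * (\<Sum>t<N. gap t) + real N * (l * \<eta>x\<^sup>2 * L\<^sup>2)"
  proof (induction N)
    case (Suc N)
    with env_gradient_step_le[OF ys_in \<eta>x_nonneg, of "xs N" N] show ?case
      by (simp add: xs_Suc gap_def[of N] algebra_simps)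
  qed simp
  moreover have "(INF x. env x) \<le> env (xs N)"
    by (rule cINF_lower[OF env_bdd_below]) simp
  ultimately show ?thesis
    by linarith
qed

text \<open>Blocks of length about \<^term>\<open>1000 * X\<close> balance the drift within a block against the cost
  \<^term>\<open>l * (diameter Y)\<^sup>2\<close> of restarting. For fewer iterations than one block, the hypothesis on
  \<^term>\<open>N\<close> makes the initial gap small.\<close>

lemma average_gap_le:
  assumes X: "1 \<le> X" "(l * diameter Y)\<^sup>2 = X * e"
    and step: "10 ^ 6 * X * (l * (\<eta>x * L\<^sup>2)) \<le> e"
    and initial: "10 ^ 9 * X * (l * gap 0) \<le> real N * e"
  shows "l * (\<Sum>t<N. gap t) \<le> real N * e / 100"
proof -
  define u where "u = l * (\<eta>x * L\<^sup>2)"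
  define b where "b = nat \<lceil>1000 * X\<rceil>"
  \<comment> \<open>The ceiling and the extra 1 are absorbed by \<open>2 * X\<close>, as
    \<open>X\<close> is at least 1.\<close>
  have b: "1000 * X \<le> real b" "real b + 1 \<le> 1002 * X"
    using X(1) unfolding b_def by linarith+
  have b_pos: "0 < b"
    using b X(1) by (cases b) auto
  have u_nonneg: "0 \<le> u"
    using l_pos \<eta>x_nonneg by (simp add: u_def)
  have "0 \<le> 10 ^ 6 * X * u"
    using u_nonneg X(1) by simp
  then have e_nonneg: "0 \<le> e"
    using step unfolding u_def by linarith
  have ub: "u * (real b + 1) \<le> 1002 / 10 ^ 6 * e"
  proof -
    have "u * (real b + 1) \<le> u * (1002 * X)"
      using b u_nonneg by (intro mult_left_mono) auto
    with step show ?thesis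
      unfolding u_def[symmetric] by (simp add: algebra_simps)
  qed
  have g0: "10 ^ 9 * (l * gap 0) \<le> real N * e"
  proof -
    have "10 ^ 9 * (l * gap 0) * 1 \<le> 10 ^ 9 * (l * gap 0) * X"
      using X(1) l_pos gap_nonneg by (intro mult_left_mono) auto
    with initial show ?thesis
      by (simp add: algebra_simps)
  qed
  show ?thesis
  proof (cases "N < b")
    case True
    \<comment> \<open>Since \<open>N\<close> is below \<open>1002 * X\<close>, the factor
      \<open>X\<close> cancels from \<open>initial\<close>, and the initial gap itself is
      small.\<close>
    have "X * (10 ^ 9 * (l * gap 0)) \<le> real N * e"
      using initial by (simp add: algebra_simps)
    also have "\<dots> \<le> 1002 * X * e"
      using True b e_nonneg by (intro mult_right_mono) auto
    finally have "X * (10 ^ 9 * (l * gap 0)) \<le> X * (1002 * e)"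
      by (simp add: algebra_simps)
    then have "l * gap 0 \<le> 1002 / 10 ^ 9 * e"
      using X(1) by simp
    moreover have "u * real N \<le> u * (real b + 1)"
      using True u_nonneg by (intro mult_left_mono) auto
    ultimately have "l * gap 0 + u * real N \<le> e / 100"
      using ub e_nonneg by simp
    then have "real N * (l * gap 0 + u * real N) \<le> real N * (e / 100)"
      by (intro mult_left_mono) auto
    moreover have "l * (\<Sum>t<N. gap t) \<le> l * (real N * gap 0 + \<eta>x * L\<^sup>2 * (real N)\<^sup>2)"
      using sum_gap_le l_pos by (intro mult_left_mono) auto
    ultimately show ?thesis
      by (simp add: u_def algebra_simps power2_eq_square)
  next
    case False
    \<comment> \<open>Now \<open>M\<close> blocks cover the run, and \<open>N\<close> being at least
      \<open>b\<close>, they overshoot by at most a factor 2.\<close>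
    define M where "M = Suc (N div b)"
    have "N < M * b"
      unfolding M_def using b_pos by (simp add: dividend_less_div_times)
    have "N div b * b \<le> N"
      by (rule div_times_less_eq_dividend)
    then have "M * b \<le> 2 * N"
      using False unfolding M_def mult_Suc by linarith
    then have Mb: "real M * real b \<le> 2 * real N"
      by (metis of_nat_le_iff of_nat_mult of_nat_numeral)
    have "(\<Sum>t<N. gap t) \<le> (\<Sum>t<M * b. gap t)"
      using \<open>N < M * b\<close> gap_nonneg by (intro sum_mono2) auto
    also have "\<dots> \<le> real M * (\<eta>x * L\<^sup>2 * (real b * (real b + 1)) + l * (diameter Y)\<^sup>2) + gap 0"
      using sum_gap_blocks_le[where m = M and b = b] gap_nonneg[of "M * b"] by linarith
    finally have "l * (\<Sum>t<N. gap t)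
        \<le> l * (real M * (\<eta>x * L\<^sup>2 * (real b * (real b + 1)) + l * (diameter Y)\<^sup>2) + gap 0)"
      using l_pos by (intro mult_left_mono) auto
    also have "\<dots> = real M * real b * (u * (real b + 1)) + real M * (X * e) + l * gap 0"
      unfolding X(2)[symmetric] by (simp add: u_def algebra_simps power2_eq_square)
    also have "real M * real b * (u * (real b + 1)) \<le> 2 * real N * (1002 / 10 ^ 6 * e)"
      by (rule mult_mono[OF Mb ub]) (use u_nonneg in auto)
    also have "real M * (X * e) \<le> 2 * real N * (e / 1000)"
    proof -
      have "real M * (X * e) = real M * (1000 * X) * (e / 1000)"
        by simp
      also have "\<dots> \<le> real M * real b * (e / 1000)"
        using b e_nonneg by (intro mult_right_mono mult_left_mono) auto
      also have "\<dots> \<le> 2 * real N * (e / 1000)"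
        using Mb e_nonneg by (intro mult_right_mono) auto
      finally show ?thesis .
    qed
    \<comment> \<open>The three contributions are about 2/1000, 2/1000 and 1/10^9 of
      \<open>real N * e\<close>, together below 1/100.\<close>
    finally show ?thesis
      using g0 mult_nonneg_nonneg[OF of_nat_0_le_iff[of N] e_nonneg] by (simp add: mult.commute)
  qed
qed

text \<open>The upper bound on \<open>\<eta>x\<close> controls the drift within a block; the lower
  bound lets \<open>T\<close> steps use up the initial excess of the envelope. The bound on
  \<open>Suc T\<close> suits the rounding down in the theorem.\<close>

lemma average_grad_env_le:
  fixes T :: nat
  assumes \<epsilon>: "0 < \<epsilon>" "\<epsilon> \<le> l * diameter Y"
    and step_ge: "1 / 10 ^ 7 * (\<epsilon> ^ 4 / (l ^ 3 * L\<^sup>2 * (diameter Y)\<^sup>2)) \<le> \<eta>x"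
    and step_le: "\<eta>x \<le> 1 / 10 ^ 6 * (\<epsilon> ^ 4 / (l ^ 3 * L\<^sup>2 * (diameter Y)\<^sup>2))"
    and T: "1 \<le> T"
      "10 ^ 9 * (l ^ 3 * L\<^sup>2 * (diameter Y)\<^sup>2 * (env x0 - (INF x. env x)) / \<epsilon> ^ 6
        + l ^ 3 * (diameter Y)\<^sup>2 * gap 0 / \<epsilon> ^ 4) \<le> real (Suc T)"
  shows "(\<Sum>t=1..T. (norm (grad env (xs t)))\<^sup>2) \<le> real T * \<epsilon>\<^sup>2"
proof (cases "L = 0")
  \<comment> \<open>Division by zero makes both step bounds 0, so \<open>\<eta>x = 0\<close> and the
    descent argument gives nothing; but the envelope then has zero gradient everywhere.\<close>
  case True
  then have "grad env x = 0" for x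
    using norm_grad_env_le[OF primal_lipschitz] by simp
  then show ?thesis
    by simp
next
  case False
  then have L_pos: "0 < L"
    using L_nonneg by simp
  define D where "D = diameter Y"
  define \<Delta> where "\<Delta> = env x0 - (INF x. env x)"
  define N where "N = Suc T"
  define A where "A = l ^ 3 * L\<^sup>2 * D\<^sup>2 * \<Delta> / \<epsilon> ^ 6"
  define B where "B = l ^ 3 * D\<^sup>2 * gap 0 / \<epsilon> ^ 4"
  \<comment> \<open>The square of \<open>l * D / \<epsilon>\<close>, the scale of the block
    length.\<close>
  define X where "X = l\<^sup>2 * D\<^sup>2 / \<epsilon>\<^sup>2"
  note fold = D_def[symmetric] \<Delta>_def[symmetric] N_def[symmetric]
  have "0 < l * D"
    using \<epsilon> unfolding fold by linarith
  then have D_pos: "0 < D"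
    using l_pos by (simp add: zero_less_mult_iff)
  have N: "10 ^ 9 * A + 10 ^ 9 * B \<le> real N" "real N \<le> 2 * real T"
    using T unfolding fold A_def B_def by (simp_all add: N_def)
  have "\<Delta> \<ge> 0"
    unfolding \<Delta>_def using cINF_lower[OF env_bdd_below, of x0] by simp
  then have AB: "0 \<le> A" "0 \<le> B"
    using l_pos gap_nonneg[of 0] \<epsilon>(1) unfolding A_def B_def by auto
  have "0 < 1 / 10 ^ 7 * (\<epsilon> ^ 4 / (l ^ 3 * L\<^sup>2 * D\<^sup>2))"
    using \<epsilon>(1) l_pos L_pos D_pos by simp
  then have \<eta>x_pos: "0 < \<eta>x"
    using step_ge unfolding fold by linarith
  have X_ge: "1 \<le> X"
    using power_mono[OF \<epsilon>(2), of 2] \<epsilon>(1) unfolding fold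
    by (simp add: X_def power_mult_distrib)
  have drift: "10 ^ 6 * X * (l * (\<eta>x * L\<^sup>2)) \<le> \<epsilon>\<^sup>2"
  proof -
    have "10 ^ 6 * X * (l * (\<eta>x * L\<^sup>2)) = \<eta>x * (10 ^ 6 * X * l * L\<^sup>2)"
      by simp
    also have "\<dots> \<le> 1 / 10 ^ 6 * (\<epsilon> ^ 4 / (l ^ 3 * L\<^sup>2 * D\<^sup>2)) * (10 ^ 6 * X * l * L\<^sup>2)"
      using step_le X_ge l_pos unfolding fold by (intro mult_right_mono) auto
    also have "\<dots> = \<epsilon>\<^sup>2"
      using \<epsilon>(1) l_pos L_pos D_pos unfolding X_def by (simp add: field_simps eval_nat_numeral)
    finally show ?thesis .
  qed
  have gaps: "l * (\<Sum>t<N. gap t) \<le> real N * \<epsilon>\<^sup>2 / 100"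
  proof (rule average_gap_le[OF X_ge _ drift])
    show "(l * diameter Y)\<^sup>2 = X * \<epsilon>\<^sup>2"
      using \<epsilon>(1) unfolding fold by (simp add: X_def power_mult_distrib)
    have "10 ^ 9 * X * (l * gap 0) = 10 ^ 9 * B * \<epsilon>\<^sup>2"
      using \<epsilon>(1) by (simp add: X_def B_def field_simps eval_nat_numeral)
    also have "\<dots> \<le> real N * \<epsilon>\<^sup>2"
      using N(1) AB by (intro mult_right_mono) auto
    finally show "10 ^ 9 * X * (l * gap 0) \<le> real N * \<epsilon>\<^sup>2" .
  qed
  have small: "l * (\<eta>x * L\<^sup>2) \<le> \<epsilon>\<^sup>2 / 10 ^ 6"
  proof -
    have "1 * (l * (\<eta>x * L\<^sup>2)) \<le> X * (l * (\<eta>x * L\<^sup>2))"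
      using X_ge l_pos \<eta>x_nonneg by (intro mult_right_mono) auto
    with drift show ?thesis
      by simp
  qed
  \<comment> \<open>The 100 is the quotient of 10^9 in the bound on \<open>N\<close> by 10^7 in the
    step size.\<close>
  have envelope: "\<Delta> \<le> \<eta>x * (real N * \<epsilon>\<^sup>2 / 100)"
  proof -
    have "\<Delta> = 1 / 10 ^ 7 * (\<epsilon> ^ 4 / (l ^ 3 * L\<^sup>2 * D\<^sup>2)) * (10 ^ 7 * A * \<epsilon>\<^sup>2)"
      using \<epsilon>(1) l_pos L_pos D_pos unfolding A_def by (simp add: field_simps eval_nat_numeral)
    also have "\<dots> \<le> \<eta>x * (10 ^ 7 * A * \<epsilon>\<^sup>2)"
      using step_ge AB unfolding fold by (intro mult_right_mono) auto
    also have "\<dots> \<le> \<eta>x * (real N * \<epsilon>\<^sup>2 / 100)"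
    proof (intro mult_left_mono \<eta>x_nonneg)
      have "10 ^ 9 * A * \<epsilon>\<^sup>2 \<le> real N * \<epsilon>\<^sup>2"
        using N(1) AB by (intro mult_right_mono) auto
      then show "10 ^ 7 * A * \<epsilon>\<^sup>2 \<le> real N * \<epsilon>\<^sup>2 / 100"
        by simp
    qed
    finally show ?thesis .
  qed
  let ?S = "\<Sum>t<N. (norm (grad env (xs t)))\<^sup>2"
  have "\<eta>x * (?S / 4) \<le> \<Delta> + \<eta>x * (2 * (l * (\<Sum>t<N. gap t))) + \<eta>x * (real N * (l * (\<eta>x * L\<^sup>2)))"
    using sum_grad_env_le[of N] unfolding fold by (simp add: algebra_simps power2_eq_square)
  also have "\<dots> \<le> \<eta>x * (real N * \<epsilon>\<^sup>2 / 100) + \<eta>x * (2 * (real N * \<epsilon>\<^sup>2 / 100))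
      + \<eta>x * (real N * (\<epsilon>\<^sup>2 / 10 ^ 6))"
    using envelope gaps small \<eta>x_nonneg by (intro add_mono mult_left_mono) auto
  \<comment> \<open>After multiplication by 4 and \<open>real N \<le> 2 * real T\<close>, this
    leaves about 0.24 of the allowed \<open>real T * \<epsilon>\<^sup>2\<close>.\<close>
  also have "\<dots> = \<eta>x * (real N * \<epsilon>\<^sup>2 * (30001 / 1000000))"
    by (simp add: algebra_simps)
  finally have "?S / 4 \<le> real N * \<epsilon>\<^sup>2 * (30001 / 1000000)"
    using \<eta>x_pos by simp
  moreover have "real N * \<epsilon>\<^sup>2 \<le> 2 * real T * \<epsilon>\<^sup>2"
    using N(2) by (intro mult_right_mono) auto
  moreover have "(\<Sum>t=1..T. (norm (grad env (xs t)))\<^sup>2) \<le> ?S"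
    by (rule sum_mono2) (auto simp: N_def)
  moreover have "0 \<le> real T * \<epsilon>\<^sup>2"
    by simp
  ultimately show ?thesis
    by linarith
qed

end

section \<open>From sums along the run to the random output\<close>

lemma gda_gradient_evals_eq: "gda_gradient_evals f Y \<eta>x \<eta>y z0 T = T"
  by (induction T) (simp_all add: gda_gradient_evals_def split_beta Let_def)

lemma stationary_gda_output_iff:
  assumes "1 \<le> T"
  shows "stationary_in_expectation l g \<epsilon> (gda_output f Y \<eta>x \<eta>y z0 T) \<longleftrightarrow>
    (\<Sum>t=1..T. (norm (grad (moreau_envelope (1 / (2 * l)) g) (gda_x f Y \<eta>x \<eta>y z0 t)))\<^sup>2)
      \<le> real T * \<epsilon>\<^sup>2"
  using assms
  by (simp add: stationary_in_expectation_def gda_output_def integral_pmf_of_set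
      divide_le_eq mult.commute)

text \<open>The hidden constants are explicit. The maximum with 1 is there because at least one
  iterate must be available for sampling.\<close>

theorem theorem4p9:
  fixes f :: "(real ^ 'm) \<times> (real ^ 'n) \<Rightarrow> real"
    and Y :: "(real ^ 'n) set"
    and l L D \<epsilon> \<eta>x \<eta>y :: real
    and x0 :: "real ^ 'm" and y0 :: "real ^ 'n"
  defines "\<Phi> \<equiv> primal_fun f Y"
  defines "\<Phi>env \<equiv> moreau_envelope (1 / (2 * l)) \<Phi>"
  defines "\<Delta>\<Phi> \<equiv> \<Phi>env x0 - (INF x. \<Phi>env x)"
  defines "\<Delta>0 \<equiv> \<Phi> x0 - f (x0, y0)"
  assumes "l > 0" and "smooth_fun l f"
    and "\<And>y. y \<in> Y \<Longrightarrow> L-lipschitz_on UNIV (\<lambda>x. f (x, y))"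
    and "\<And>x. concave_on UNIV (\<lambda>y. f (x, y))"
    and "convex Y" and "bounded Y" and "closed Y" and "Y \<noteq> {}" and "diameter Y = D"
    and "bdd_below (range \<Phi>)"
    and "y0 \<in> Y"
    and "0 < \<epsilon>" and "\<epsilon> \<le> l * D"
    and "1 / 10 ^ 7 * (\<epsilon> ^ 4 / (l ^ 3 * L\<^sup>2 * D\<^sup>2)) \<le> \<eta>x"
    and "\<eta>x \<le> 1 / 10 ^ 6 * (\<epsilon> ^ 4 / (l ^ 3 * L\<^sup>2 * D\<^sup>2))"
    and "1 / 2 * (1 / l) \<le> \<eta>y" and "\<eta>y \<le> 1 / l"
  shows "\<exists>T0 \<ge> 1.
    real T0 \<le> max 1 (10 ^ 9 * (l ^ 3 * L\<^sup>2 * D\<^sup>2 * \<Delta>\<Phi> / \<epsilon> ^ 6 + l ^ 3 * D\<^sup>2 * \<Delta>0 / \<epsilon> ^ 4)) \<and>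
    real (gda_gradient_evals f Y \<eta>x \<eta>y (x0, y0) T0)
      \<le> max 1 (10 ^ 9 * (l ^ 3 * L\<^sup>2 * D\<^sup>2 * \<Delta>\<Phi> / \<epsilon> ^ 6 + l ^ 3 * D\<^sup>2 * \<Delta>0 / \<epsilon> ^ 4)) \<and>
    (\<forall>T \<ge> T0. stationary_in_expectation l \<Phi> \<epsilon> (gda_output f Y \<eta>x \<eta>y (x0, y0) T))"
proof -
  have "0 \<le> 1 / 10 ^ 7 * (\<epsilon> ^ 4 / (l ^ 3 * L\<^sup>2 * D\<^sup>2))"
    using \<open>l > 0\<close> \<open>0 < \<epsilon>\<close> by simp
  then have "0 \<le> \<eta>x"
    using \<open>1 / 10 ^ 7 * (\<epsilon> ^ 4 / (l ^ 3 * L\<^sup>2 * D\<^sup>2)) \<le> \<eta>x\<close> by linarith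
  interpret gda f Y l L \<eta>x \<eta>y x0 y0
    by unfold_locales (fact assms(5-21)[unfolded \<Phi>_def] \<open>0 \<le> \<eta>x\<close>)+
  define K where "K = 10 ^ 9 * (l ^ 3 * L\<^sup>2 * D\<^sup>2 * \<Delta>\<Phi> / \<epsilon> ^ 6 + l ^ 3 * D\<^sup>2 * \<Delta>0 / \<epsilon> ^ 4)"
  \<comment> \<open>Rounding down keeps \<open>T0\<close> within the bound, at the price of
    \<open>K \<le> real T0 + 1\<close>; this is why \<open>average_grad_env_le\<close> is stated
    with \<open>Suc T\<close>.\<close>
  define T0 where "T0 = max 1 (nat \<lfloor>K\<rfloor>)"
  have T0: "1 \<le> T0" "real T0 \<le> max 1 K" "K \<le> real T0 + 1"
    unfolding T0_def by linarith+
  have "stationary_in_expectation l \<Phi> \<epsilon> (gda_output f Y \<eta>x \<eta>y (x0, y0) T)" if "T \<ge> T0" for T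
  proof -
    have "1 \<le> T" "K \<le> real (Suc T)"
      using T0 that by simp_all
    then show ?thesis
      unfolding stationary_gda_output_iff[OF \<open>1 \<le> T\<close>] \<Phi>_def
      by (intro average_grad_env_le)
        (use assms(16-19) in \<open>simp_all add: \<open>diameter Y = D\<close> K_def \<Delta>\<Phi>_def \<Phi>env_def \<Phi>_def \<Delta>0_def gap_def\<close>)
  qed
  with T0 show ?thesis
    unfolding gda_gradient_evals_eq K_def[symmetric] by blast
qed

end
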